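(* Let $G$ be a finite group and let $p$ be a prime. If $d_{p'}(G)>2/(p+1)$, then $G$ has a normal Sylow $p$-subgroup.
   Context: For a finite group $G$ and prime $p$, $k_{p'}(G)$ denotes the number of conjugacy classes of elements of $G$ whose order is not divisible by $p$, $|G|_{p'}$ is the largest divisor of $|G|$ coprime to $p$, and $d_{p'}(G)=k_{p'}(G)/|G|_{p'}$. *)

theory Defs
  imports "HOL-Algebra.Algebra" "HOL-Computational_Algebra.Primes" Complex_Main
begin

definition conj_class :: "('a, 'b) monoid_scheme \<Rightarrow> 'a \<Rightarrow> 'a set" where
  "conj_class G x = {g \<otimes>\<^bsub>G\<^esub> x \<otimes>\<^bsub>G\<^esub> inv\<^bsub>G\<^esub> g | g. g \<in> carrier G}"

definition p'_elements :: "('a, 'b) monoid_scheme \<Rightarrow> nat \<Rightarrow> 'a set" where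
  "p'_elements G p = {x \<in> carrier G. \<not> p dvd group.ord G x}"

definition k_p' :: "('a, 'b) monoid_scheme \<Rightarrow> nat \<Rightarrow> nat" where
  "k_p' G p = card (conj_class G ` p'_elements G p)"

definition order_p' :: "('a, 'b) monoid_scheme \<Rightarrow> nat \<Rightarrow> nat" where
  "order_p' G p = Max {d. d dvd order G \<and> coprime d p}"

definition d_p' :: "('a, 'b) monoid_scheme \<Rightarrow> nat \<Rightarrow> real" where
  "d_p' G p = real (k_p' G p) / real (order_p' G p)"

definition sylow_subgroup :: "('a, 'b) monoid_scheme \<Rightarrow> nat \<Rightarrow> 'a set \<Rightarrow> bool" where
  "sylow_subgroup G p P \<longleftrightarrow> subgroup P G \<and> card P = p ^ multiplicity p (order G)"

end

theory Submission
  imports Defs "HOL-Library.Poly_Mapping" "HOL-Number_Theory.Number_Theory"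
begin

text \<open>
  Let \<open>P\<close> be a Sylow \<open>p\<close>-subgroup.  The number of \<open>p\<close>-regular classes is at most the number of double
  cosets \<open>P x P\<close>: in characteristic \<open>p\<close> every simple module \<open>V\<close> and its dual have nonzero \<open>P\<close>-fixed
  vectors, so each simple component \<open>V \<otimes> V*\<close> of the semisimple quotient of the group ring contains a
  nonzero element fixed by \<open>P\<close> on both sides.  If \<open>P\<close> is not normal, then \<open>P\<close> has
  \<open>|N(P) : P|\<close> fixed points on the cosets of \<open>P\<close>, at most a fraction \<open>1 / (p + 1)\<close> of all of them, and
  its other orbits have length at least \<open>p\<close>; hence there are at most \<open>2 / (p + 1) |G : P|\<close> double cosets.

  The bound on the classes is obtained over the prime field without modules.  A function on the
  \<open>p\<close>-regular classes extends to a trace form \<open>r\<close> on the group ring with \<open>r (a ^ q) = r a\<close> modulo \<open>p\<close>,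
  where \<open>q\<close> is a power of \<open>p\<close> such that \<open>g ^ q\<close> is the \<open>p'\<close>-part of \<open>g\<close>; these forms therefore vanish on
  nilpotent elements.  One finds a single element \<open>b\<close> of the group ring that is fixed by \<open>P\<close> on both
  sides modulo the common radical of the forms, and such that \<open>r (b x)\<close> does not vanish identically
  in \<open>x\<close> unless \<open>r = 0\<close>.  Then \<open>r\<close> is determined by the function \<open>x \<mapsto> r (b x)\<close> on the double
  cosets.
\<close>

section \<open>Actions of finite p-groups: orbits and fixed points modulo p\<close>

text \<open>The function \<open>act\<close> is constrained on \<open>E\<close> only, so that
  rotations of words, translations of functions and shifts of cosets can be plugged in directly;
  \<open>group_action\<close> restricts it to \<open>E\<close> to reach the orbit theory of the
  library.\<close>

locale p_group_action = group H for H (structure) +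
  fixes E :: "'e set" and act :: "'a \<Rightarrow> 'e \<Rightarrow> 'e" and p n :: nat
  assumes fin: "finite E" and prime_p: "Factorial_Ring.prime p"
    and card_H: "card (carrier H) = p ^ n"
    and act_closed: "\<lbrakk>h \<in> carrier H; x \<in> E\<rbrakk> \<Longrightarrow> act h x \<in> E"
    and act_one: "x \<in> E \<Longrightarrow> act \<one> x = x"
    and act_mult: "\<lbrakk>h \<in> carrier H; k \<in> carrier H; x \<in> E\<rbrakk> \<Longrightarrow> act (h \<otimes> k) x = act h (act k x)"
begin

definition orb :: "'e \<Rightarrow> 'e set" where
  "orb x = (\<lambda>h. act h x) ` carrier H"

definition fixed :: "'e set" where
  "fixed = {x \<in> E. \<forall>h \<in> carrier H. act h x = x}"

lemma group_action: "group_action H E (\<lambda>h. \<lambda>x\<in>E. act h x)"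
proof -
  have bij: "bij_betw (act h) E E" if "h \<in> carrier H" for h
    by (rule bij_betwI[where g = "act (inv h)"])
      (auto simp: that act_closed act_one simp flip: act_mult)
  have "(\<lambda>x\<in>E. act h x) \<in> Bij E" if "h \<in> carrier H" for h
    using bij[OF that] by (simp add: Bij_def cong: bij_betw_cong)
  then have "(\<lambda>h. \<lambda>x\<in>E. act h x) \<in> hom H (BijGroup E)"
    by (auto simp: hom_def BijGroup_def fun_eq_iff compose_def act_mult act_closed)
  then show ?thesis
    by (simp add: group_action_def group_hom_def group_hom_axioms_def group_BijGroup is_group)
qed

lemma orb_eq_orbit: "x \<in> E \<Longrightarrow> orb x = orbit H (\<lambda>h. \<lambda>x\<in>E. act h x) x"
  by (auto simp: orb_def orbit_def)

lemma orbits_eq: "orbits H E (\<lambda>h. \<lambda>x\<in>E. act h x) = orb ` E"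
  by (auto simp: orbits_def orb_eq_orbit)

lemma mem_orb: "x \<in> E \<Longrightarrow> x \<in> orb x"
  unfolding orb_def by (rule image_eqI[of _ _ \<one>]) (auto simp: act_one)

lemma orb_subset: "x \<in> E \<Longrightarrow> orb x \<subseteq> E"
  by (auto simp: orb_def act_closed)

lemma orb_act: "h \<in> carrier H \<Longrightarrow> x \<in> E \<Longrightarrow> orb (act h x) = orb x"
proof -
  assume h: "h \<in> carrier H" and x: "x \<in> E"
  interpret group_action H E "\<lambda>h. \<lambda>x\<in>E. act h x" by (rule group_action)
  have "act h x \<in> orb x \<inter> orb (act h x)"
    using h x mem_orb[OF act_closed[OF h x]] by (auto simp: orb_def)
  moreover have "orb x \<in> orb ` E" "orb (act h x) \<in> orb ` E" using h x act_closed by auto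
  ultimately show ?thesis using disjoint_union[unfolded orbits_eq] by blast
qed

lemma card_orb: "x \<in> E \<Longrightarrow> card (orb x) dvd p ^ n"
  using group_action.orbit_stabilizer_theorem[OF group_action, of x]
  by (metis card_H dvdI orb_eq_orbit order_def)

lemma orb_fixed: "x \<in> fixed \<Longrightarrow> orb x = {x}"
  by (auto simp: fixed_def orb_def)

text \<open>By orbit-stabilizer the length is a power of \<open>p\<close>, and exponent 0 would make
  the orbit a singleton, hence \<open>x\<close> fixed.\<close>

lemma p_dvd_card_orb: "x \<in> E \<Longrightarrow> x \<notin> fixed \<Longrightarrow> p dvd card (orb x)"
proof -
  assume x: "x \<in> E" "x \<notin> fixed"
  obtain i where i: "card (orb x) = p ^ i"
    using card_orb[OF x(1)] prime_p by (metis divides_primepow_nat)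
  have "i \<noteq> 0"
  proof
    assume "i = 0"
    then obtain y where "orb x = {y}" using i by (auto simp: card_1_singleton_iff)
    then have "orb x = {x}" using mem_orb[OF x(1)] by auto
    then show False using x by (auto simp: fixed_def orb_def)
  qed
  then show ?thesis using i by simp
qed

lemma orb_nonfixed: "x \<in> E \<Longrightarrow> x \<notin> fixed \<Longrightarrow> orb x \<inter> fixed = {}"
proof (rule ccontr)
  assume x: "x \<in> E" "x \<notin> fixed" and "orb x \<inter> fixed \<noteq> {}"
  then obtain h where h: "h \<in> carrier H" "act h x \<in> fixed" by (auto simp: orb_def)
  then have "orb x = {act h x}" using orb_act[OF h(1) x(1)] orb_fixed[OF h(2)] by simp
  then show False using mem_orb[OF x(1)] h x by auto
qed

text \<open>On an orbit outside \<open>fixed\<close> the function is constant modulo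
  \<open>p\<close> and the length is divisible by \<open>p\<close>, so the orbit contributes
  0.\<close>

lemma sum_cong_fixed:
  fixes f :: "'e \<Rightarrow> int"
  assumes inv: "\<And>h x. h \<in> carrier H \<Longrightarrow> x \<in> E \<Longrightarrow> [f (act h x) = f x] (mod int p)"
  shows "[(\<Sum>x\<in>E. f x) = (\<Sum>x\<in>fixed. f x)] (mod int p)"
proof -
  interpret group_action H E "\<lambda>h. \<lambda>x\<in>E. act h x" by (rule group_action)
  let ?g = "\<lambda>x. if x \<in> fixed then f x else 0"
  have orb_sum: "[(\<Sum>y\<in>orb x. f y) = (\<Sum>y\<in>orb x. ?g y)] (mod int p)" if x: "x \<in> E" for x
  proof (cases "x \<in> fixed")
    case True
    then show ?thesis by (simp add: orb_fixed)
  next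
    case False
    have "[(\<Sum>y\<in>orb x. f y) = (\<Sum>y\<in>orb x. f x)] (mod int p)"
      by (rule cong_sum) (auto simp: orb_def inv x)
    also have "(\<Sum>y\<in>orb x. f x) = int (card (orb x)) * f x" by simp
    also have "[int (card (orb x)) * f x = 0] (mod int p)"
      using p_dvd_card_orb[OF x False] by (simp add: cong_0_iff)
    also have "0 = (\<Sum>y\<in>orb x. ?g y)"
      using orb_nonfixed[OF x False] by (intro sum.neutral[symmetric]) auto
    finally show ?thesis .
  qed
  have "[(\<Sum>B\<in>orb ` E. \<Sum>y\<in>B. f y) = (\<Sum>B\<in>orb ` E. \<Sum>y\<in>B. ?g y)] (mod int p)"
    by (rule cong_sum) (use orb_sum in auto)
  then have "[(\<Sum>x\<in>E. f x) = (\<Sum>x\<in>E. ?g x)] (mod int p)"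
    using disjoint_sum[OF fin, unfolded orbits_eq] by metis
  also have "(\<Sum>x\<in>E. ?g x) = (\<Sum>x\<in>fixed. f x)"
    using fin by (simp add: sum.If_cases fixed_def Int_def conj_ac)
  finally show ?thesis .
qed

lemma card_cong_fixed: "[card E = card fixed] (mod p)"
  using sum_cong_fixed[of "\<lambda>_. 1"] by (simp add: cong_int_iff)

text \<open>Give weight \<open>p\<close> to fixed points and weight 1 to all other points. Every
  orbit then weighs at least \<open>p\<close>, and the total weight is the right-hand side.\<close>

lemma card_orbits_le: "p * card (orb ` E) \<le> card E + (p - 1) * card fixed"
proof -
  interpret group_action H E "\<lambda>h. \<lambda>x\<in>E. act h x" by (rule group_action)
  have fixE: "fixed \<subseteq> E" by (auto simp: fixed_def)
  have p0: "p > 0" using prime_p by (simp add: prime_gt_0_nat)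
  have "p \<le> (\<Sum>y\<in>orb x. if y \<in> fixed then p else 1)" if x: "x \<in> E" for x
  proof (cases "x \<in> fixed")
    case True
    then show ?thesis by (simp add: orb_fixed)
  next
    case False
    have "(\<Sum>y\<in>orb x. if y \<in> fixed then p else 1) = (\<Sum>y\<in>orb x. 1)"
      using orb_nonfixed[OF x False] by (intro sum.cong) auto
    moreover have "finite (orb x)" using orb_subset[OF x] fin finite_subset by blast
    ultimately show ?thesis
      using p_dvd_card_orb[OF x False] mem_orb[OF x] by (auto intro!: dvd_imp_le simp: card_gt_0_iff)
  qed
  then have "(\<Sum>B\<in>orb ` E. p) \<le> (\<Sum>B\<in>orb ` E. \<Sum>y\<in>B. if y \<in> fixed then p else 1)"
    by (intro sum_mono) auto
  also have "\<dots> = (\<Sum>y\<in>E. if y \<in> fixed then p else 1)"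
    using disjoint_sum[OF fin, unfolded orbits_eq] by metis
  also have "\<dots> = (\<Sum>y\<in>E. 1 + (if y \<in> fixed then p - 1 else 0))"
    using p0 by (intro sum.cong) auto
  also have "\<dots> = card E + (p - 1) * card fixed"
    using fin fixE by (subst sum.distrib) (simp add: sum.If_cases Int_absorb1 mult.commute)
  finally show ?thesis by (simp add: mult.commute)
qed

end

section \<open>Powers of sums under trace forms\<close>

text \<open>The summands need not commute, so the expansion runs over ordered words; these carry the
  rotation action used next.\<close>

lemma sum_power_eq_sum_lists:
  fixes x :: "'i \<Rightarrow> 'r::ring_1"
  assumes "finite I"
  shows "(\<Sum>i\<in>I. x i) ^ n = (\<Sum>ws\<in>{ws. set ws \<subseteq> I \<and> length ws = n}. prod_list (map x ws))"
proof (induction n)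
  case 0
  have "{ws. set ws \<subseteq> I \<and> ws = []} = {[]}" by auto
  then show ?case by simp
next
  case (Suc n)
  let ?L = "\<lambda>n. {ws. set ws \<subseteq> I \<and> length ws = n}"
  have eq: "?L (Suc n) = (\<lambda>(i, ws). i # ws) ` (I \<times> ?L n)"
    by (auto simp: length_Suc_conv image_iff)
  have "(\<Sum>ws\<in>?L (Suc n). prod_list (map x ws)) = (\<Sum>(i, ws)\<in>I \<times> ?L n. x i * prod_list (map x ws))"
    unfolding eq by (subst sum.reindex) (auto simp: inj_on_def intro!: sum.cong)
  also have "\<dots> = (\<Sum>i\<in>I. x i) * (\<Sum>ws\<in>?L n. prod_list (map x ws))"
    by (simp add: sum_product sum.cartesian_product)
  finally show ?case by (simp add: Suc.IH)
qed

text \<open>The cyclic group of order $p^n$ rotates the words of length $p^n$, a trace form does not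
  see rotations modulo $p$, and only constant words are fixed.\<close>

lemma trace_power_sum_cong:
  fixes r :: "'r::ring_1 \<Rightarrow> int"
  assumes p: "Factorial_Ring.prime p" and fin: "finite I"
    and add: "\<And>x y. r (x + y) = r x + r y"
    and comm: "\<And>x y. r (x * y) = r (y * x)"
  shows "[r ((\<Sum>i\<in>I. x i) ^ (p ^ n)) = (\<Sum>i\<in>I. r (x i ^ (p ^ n)))] (mod int p)"
proof -
  let ?q = "p ^ n"
  define L where "L = {ws. set ws \<subseteq> I \<and> length ws = ?q}"
  have q0: "?q > 0" using p by (simp add: prime_gt_0_nat)
  have finL: "finite L" unfolding L_def using fin by (rule finite_lists_length_eq)
  have r0: "r 0 = 0" using add[of 0 0] by simp
  have rsum: "r (sum g S) = (\<Sum>s\<in>S. r (g s))" for g :: "'c \<Rightarrow> 'r" and S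
    by (induction S rule: infinite_finite_induct) (auto simp: r0 add)
  have rot: "r (prod_list (rotate k zs)) = r (prod_list zs)" for k and zs :: "'r list"
  proof (induction k)
    case (Suc k)
    have "r (prod_list (rotate1 ys)) = r (prod_list ys)" for ys :: "'r list"
      by (cases ys) (auto simp: comm)
    then show ?case using Suc by simp
  qed simp
  interpret rotation: p_group_action "integer_mod_group ?q" L "\<lambda>k ws. rotate (nat k) ws" p n
  proof (intro p_group_action.intro p_group_action_axioms.intro)
    fix h k ws assume hk: "h \<in> carrier (integer_mod_group ?q)" "k \<in> carrier (integer_mod_group ?q)"
      and ws: "ws \<in> L"
    have nn: "h \<ge> 0" "k \<ge> 0" using hk q0 by (auto simp: carrier_integer_mod_group)
    have "rotate (nat ((h + k) mod int ?q)) ws = rotate (nat (h + k)) ws"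
      using ws nn rotate_conv_mod[of "nat (h + k)" ws] by (simp add: L_def nat_mod_distrib nat_power_eq)
    then show "rotate (nat (h \<otimes>\<^bsub>integer_mod_group ?q\<^esub> k)) ws = rotate (nat h) (rotate (nat k) ws)"
      using nn by (simp add: rotate_rotate nat_add_distrib)
  qed (use q0 p finL in \<open>auto simp: L_def carrier_integer_mod_group nat_power_eq\<close>)
  have fixed: "rotation.fixed = (\<lambda>i. replicate ?q i) ` I"
  proof (intro equalityI subsetI)
    fix ws assume ws: "ws \<in> rotation.fixed"
    have wsL: "ws \<in> L" using ws by (simp add: rotation.fixed_def)
    have len: "length ws = ?q" "set ws \<subseteq> I" using wsL by (auto simp: L_def)
    have all: "rotate k ws = ws" if "k < ?q" for k
      using ws that q0 unfolding rotation.fixed_def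
      by (auto simp: carrier_integer_mod_group dest!: bspec[of _ _ "int k"])
    \<comment> \<open>The head of \<open>rotate k ws\<close> is the \<open>k\<close>-th letter, so
      invariance makes all letters equal to the first.\<close>
    have "ws ! k = ws ! 0" if "k < ?q" for k
      using all[OF that] hd_rotate_conv_nth[of ws k] len that q0
      by (metis hd_conv_nth length_0_conv mod_less not_less_zero)
    then have "ws = replicate ?q (ws ! 0)"
      using len by (intro nth_equalityI) auto
    then show "ws \<in> (\<lambda>i. replicate ?q i) ` I" using len q0 by (metis image_eqI nth_mem subsetD)
  next
    fix ws assume "ws \<in> (\<lambda>i. replicate ?q i) ` I"
    moreover have "rotate k (replicate ?q i) = replicate ?q i" for k and i :: 'b
      by (induction k) auto
    ultimately show "ws \<in> rotation.fixed"
      unfolding rotation.fixed_def by (auto simp: L_def)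
  qed
  have "r ((\<Sum>i\<in>I. x i) ^ ?q) = (\<Sum>ws\<in>L. r (prod_list (map x ws)))"
    by (simp add: sum_power_eq_sum_lists[OF fin] rsum L_def)
  also have "[\<dots> = (\<Sum>ws\<in>rotation.fixed. r (prod_list (map x ws)))] (mod int p)"
    by (rule rotation.sum_cong_fixed) (simp add: rot rotate_map[symmetric])
  also have "(\<Sum>ws\<in>rotation.fixed. r (prod_list (map x ws))) = (\<Sum>i\<in>I. r (x i ^ ?q))"
    unfolding fixed using q0
    by (subst sum.reindex) (auto simp: inj_on_def prod_list_replicate)
  finally show ?thesis .
qed

section \<open>Frobenius-invariant trace forms and their radicals\<close>

text \<open>The forms have integer values but are read modulo \<open>p\<close>. The map
  \<open>F\<close> stands in for a finite quotient ring: it has finitely many values, and elements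
  with equal values differ by a member of the common radical \<open>J\<close>.\<close>

locale trace_forms =
  fixes R :: "('r::ring_1 \<Rightarrow> int) set" and p q :: nat and F :: "'r \<Rightarrow> 'f"
  assumes additive: "r \<in> R \<Longrightarrow> r (x + y) = r x + r y"
    and symmetric: "r \<in> R \<Longrightarrow> r (x * y) = r (y * x)"
    and frobenius: "r \<in> R \<Longrightarrow> [r (x ^ q) = r x] (mod int p)"
    and q_gt_1: "q > 1"
    and fin_R: "finite R"
    and fin_F: "finite (range F)"
    and F_separates: "\<lbrakk>F a = F b; r \<in> R\<rbrakk> \<Longrightarrow> [r (a * x) = r (b * x)] (mod int p)"
begin

text \<open>This is the radical modulo \<open>p\<close> of the bilinear form sending
  \<open>a\<close> and \<open>x\<close> to \<open>r (a * x)\<close>; for \<open>r\<close> in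
  \<open>R\<close> it is a two-sided ideal because \<open>r\<close> is symmetric.\<close>

definition rad :: "('r \<Rightarrow> int) \<Rightarrow> 'r set" where
  "rad r = {a. \<forall>x. int p dvd r (a * x)}"

definition J :: "'r set" where
  "J = (\<Inter>r\<in>R. rad r)"

lemma diff: "r \<in> R \<Longrightarrow> r (x - y) = r x - r y"
  using additive[of r "x - y" y] by simp

lemma zero: "r \<in> R \<Longrightarrow> r 0 = 0"
  using diff[of r 0 0] by simp

lemma rad_add: "\<lbrakk>r \<in> R; a \<in> rad r; b \<in> rad r\<rbrakk> \<Longrightarrow> a + b \<in> rad r"
  by (simp add: rad_def distrib_right additive)

lemma rad_diff: "\<lbrakk>r \<in> R; a \<in> rad r; b \<in> rad r\<rbrakk> \<Longrightarrow> a - b \<in> rad r"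
  by (simp add: rad_def left_diff_distrib diff)

lemma rad_mult_right: "a \<in> rad r \<Longrightarrow> a * x \<in> rad r"
  by (simp add: rad_def mult.assoc)

lemma rad_mult_left: "\<lbrakk>r \<in> R; a \<in> rad r\<rbrakk> \<Longrightarrow> x * a \<in> rad r"
  unfolding rad_def by (simp add: mult.assoc symmetric[of r x])

lemma rad_zero: "r \<in> R \<Longrightarrow> 0 \<in> rad r"
  by (simp add: rad_def zero)

lemma rad_dvd: "a \<in> rad r \<Longrightarrow> int p dvd r a"
  unfolding rad_def by (auto dest: spec[of _ 1])

lemma J_rad: "\<lbrakk>a \<in> J; r \<in> R\<rbrakk> \<Longrightarrow> a \<in> rad r"
  by (simp add: J_def)

lemma J_add: "a \<in> J \<Longrightarrow> b \<in> J \<Longrightarrow> a + b \<in> J"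
  by (simp add: J_def rad_add)

lemma J_diff: "a \<in> J \<Longrightarrow> b \<in> J \<Longrightarrow> a - b \<in> J"
  by (simp add: J_def rad_diff)

lemma J_mult_right: "a \<in> J \<Longrightarrow> a * x \<in> J"
  by (simp add: J_def rad_mult_right)

lemma J_mult_left: "a \<in> J \<Longrightarrow> x * a \<in> J"
  by (simp add: J_def rad_mult_left)

lemma J_zero: "0 \<in> J"
  by (simp add: J_def rad_zero)

lemma F_eq_diff_mem_J: "F a = F b \<Longrightarrow> a - b \<in> J"
  using F_separates by (auto simp: J_def rad_def left_diff_distrib diff cong_iff_dvd_diff)

text \<open>Iterating \<open>frobenius\<close> gives \<open>r (a ^ (q ^ k)) = r a\<close> modulo
  \<open>p\<close>, and \<open>q ^ k \<ge> k\<close> puts this power into the ideal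
  \<open>J\<close>.\<close>

lemma nilpotent_dvd:
  assumes r: "r \<in> R" and a: "a ^ k \<in> J"
  shows "int p dvd r a"
proof -
  have iter: "[r (a ^ (q ^ j)) = r a] (mod int p)" for j
  proof (induction j)
    case (Suc j)
    have "[r ((a ^ (q ^ j)) ^ q) = r (a ^ (q ^ j))] (mod int p)" by (rule frobenius[OF r])
    then show ?case using Suc cong_trans by (simp add: power_mult[symmetric] mult.commute)
  qed simp
  have "k \<le> q ^ k"
    using power_gt_expt[of q k] q_gt_1 by simp
  then have "a ^ (q ^ k) = a ^ k * a ^ (q ^ k - k)" by (simp flip: power_add)
  then have "a ^ (q ^ k) \<in> J" using a J_mult_right by simp
  then have "int p dvd r (a ^ (q ^ k))" using J_rad[OF _ r] rad_dvd by blast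
  then show ?thesis using iter[of k] cong_dvd_iff by blast
qed

text \<open>Every form vanishes modulo \<open>p\<close> on the nilpotent elements
  \<open>c * x\<close>, which is what membership of \<open>c\<close> in \<open>J\<close>
  means.\<close>

lemma mem_J_if_nilpotent:
  assumes "\<And>x. (c * x) ^ 2 \<in> J"
  shows "c \<in> J"
  using nilpotent_dvd[OF _ assms] by (auto simp: J_def rad_def)

text \<open>The powers of \<open>a\<close> take finitely many values under \<open>F\<close>, hence
  are eventually periodic modulo \<open>J\<close>; an exponent beyond the preperiod and divisible by
  the period \<open>d\<close> gives an idempotent.\<close>

lemma idempotent_power:
  obtains n where "n > 0" "a ^ n - a ^ n * a ^ n \<in> J"
proof -
  have "\<not> inj (\<lambda>k::nat. F (a ^ k))"
    using finite_imageD[of "\<lambda>k::nat. F (a ^ k)" UNIV] finite_subset[OF _ fin_F, of "range (\<lambda>k::nat. F (a ^ k))"] by auto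
  then obtain i j where ij: "i < j" "F (a ^ i) = F (a ^ j)"
    unfolding inj_def by (metis linorder_neqE_nat)
  define d where "d = j - i"
  have d: "d > 0" "j = i + d" using ij by (auto simp: d_def)
  have step: "a ^ m - a ^ (m + d) \<in> J" if "m \<ge> i" for m
  proof -
    have "a ^ m - a ^ (m + d) = (a ^ i - a ^ j) * a ^ (m - i)"
      using that d power_add[of a i "m - i"] power_add[of a j "m - i"]
      by (simp add: left_diff_distrib add.commute)
    then show ?thesis using F_eq_diff_mem_J[OF ij(2)] J_mult_right by simp
  qed
  have steps: "a ^ m - a ^ (m + l * d) \<in> J" if "m \<ge> i" for m l
  proof (induction l)
    case (Suc l)
    have "a ^ m - a ^ (m + Suc l * d) = (a ^ m - a ^ (m + l * d)) + (a ^ (m + l * d) - a ^ (m + l * d + d))"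
      by (simp add: algebra_simps)
    then show ?case using J_add[OF Suc step[of "m + l * d"]] that by simp
  qed (simp add: J_zero)
  \<comment> \<open>The factor is \<open>Suc i\<close> rather than \<open>i\<close> so that the
    exponent is positive even for \<open>i = 0\<close>.\<close>
  have "Suc i * d \<ge> i" using d(1) by (cases d) auto
  then have "a ^ (Suc i * d) - a ^ (Suc i * d) * a ^ (Suc i * d) \<in> J"
    using steps[of "Suc i * d" "Suc i"] by (simp only: power_add)
  then show ?thesis using that[of "Suc i * d"] d(1) by simp
qed

text \<open>The element \<open>t\<close> plays the part of the central idempotent complementary to the ideal
  \<open>rad r\<close> of the semisimple quotient by \<open>J\<close>.  As long as \<open>t * y\<close> is not in \<open>J\<close> for some \<open>y\<close> in
  \<open>rad r\<close>, the right ideal \<open>t * rad r\<close> contains an idempotent \<open>e\<close> outside \<open>J\<close>, and \<open>(1 - e) * t\<close>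
  annihilates more than \<open>t\<close>.\<close>

lemma exists_complement:
  assumes r: "r \<in> R"
  obtains t where "t - 1 \<in> rad r" "\<And>y. y \<in> rad r \<Longrightarrow> t * y \<in> J"
proof -
  let ?Q = "rad r"
  define Ann where "Ann t = {y \<in> ?Q. t * y \<in> J}" for t
  have finAnn: "finite (F ` S)" for S using fin_F by (rule finite_subset[rotated]) auto
  \<comment> \<open>Size is measured by the number of values of \<open>F\<close>, since the ring
    itself may be infinite.\<close>
  define m where "m t = card (F ` Ann t)" for t
  have bound: "\<forall>t. t - 1 \<in> ?Q \<longrightarrow> m t < Suc (card (range F))"
    unfolding m_def using fin_F by (auto intro!: le_imp_less_Suc card_mono)
  obtain t where t: "t - 1 \<in> ?Q" and max: "\<And>t'. t' - 1 \<in> ?Q \<Longrightarrow> m t' \<le> m t"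
    using ex_has_greatest_nat[of "\<lambda>t. t - 1 \<in> ?Q" 1 m, OF _ bound] rad_zero[OF r] by auto
  have "t * y \<in> J" if y: "y \<in> ?Q" for y
  proof (rule ccontr)
    assume "t * y \<notin> J"
    then obtain r' x where r': "r' \<in> R" "\<not> int p dvd r' (t * y * x)"
      by (auto simp: J_def rad_def)
    define a where "a = t * y * x"
    obtain n where n: "n > 0" "a ^ n - a ^ n * a ^ n \<in> J" by (rule idempotent_power)
    define e where "e = a ^ n"
    have eJ: "e \<notin> J" using nilpotent_dvd[OF r'(1), of a n] r'(2) by (auto simp: e_def a_def)
    \<comment> \<open>This is \<open>e\<close> without its leading factor \<open>t\<close>; it will
      be killed modulo \<open>J\<close> by \<open>t'\<close> but not by \<open>t\<close>.\<close>
    define y0 where "y0 = y * x * a ^ (n - 1)"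
    have y0: "y0 \<in> ?Q" using y rad_mult_right by (simp add: y0_def mult.assoc)
    have e: "e = t * y0" using n(1) by (cases n) (simp_all add: e_def y0_def a_def mult.assoc)
    have eQ: "e \<in> ?Q" using e rad_mult_left[OF r y0] by simp
    define t' where "t' = (1 - e) * t"
    have "t' - 1 = (t - 1) - e * t" by (simp add: t'_def algebra_simps)
    then have t': "t' - 1 \<in> ?Q" using rad_diff[OF r t rad_mult_right[OF eQ, of t]] by metis
    have "t' * y0 = e - e * e" by (simp add: t'_def mult.assoc e[symmetric] left_diff_distrib)
    then have "t' * y0 \<in> J" using n(2) by (simp add: e_def)
    then have "F y0 \<in> F ` Ann t'" using y0 by (auto simp: Ann_def)
    \<comment> \<open>Strictness must hold for the values of \<open>F\<close>: an element of
      \<open>Ann t\<close> with the value of \<open>y0\<close> differs from it by an element of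
      \<open>J\<close>, which would force \<open>e = t * y0\<close> into \<open>J\<close>.\<close>
    moreover have "F y0 \<notin> F ` Ann t"
    proof
      assume "F y0 \<in> F ` Ann t"
      then obtain z where z: "F y0 = F z" "t * z \<in> J" by (auto simp: Ann_def)
      have "t * y0 = t * (y0 - z) + t * z" by (simp add: algebra_simps)
      then have "t * y0 \<in> J"
        using J_add[OF J_mult_left[OF F_eq_diff_mem_J[OF z(1)]] z(2)] by simp
      then show False using e eJ by simp
    qed
    moreover have "Ann t \<subseteq> Ann t'" using J_mult_left by (auto simp: Ann_def t'_def mult.assoc)
    ultimately have "F ` Ann t \<subset> F ` Ann t'" by blast
    then have "m t < m t'" unfolding m_def by (intro psubset_card_mono finAnn)
    then show False using max[OF t'] by simp
  qed
  then show thesis using that t by blast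
qed

text \<open>Among the elements fixed by \<open>U\<close> modulo \<open>J\<close>, take one lying in
  the radicals of as few forms as possible. If a form that is nonzero modulo \<open>p\<close> were
  left, adding an element fixed modulo its radical, cut down to the complementary component, would
  lower this number.\<close>

lemma exists_invariant:
  assumes fixpt: "\<And>r. r \<in> R \<Longrightarrow> \<exists>x. \<not> int p dvd r x \<Longrightarrow>
    \<exists>c. c \<notin> rad r \<and> (\<forall>u\<in>U. u * c - c \<in> rad r \<and> c * u - c \<in> rad r)"
  obtains b where "\<And>u. u \<in> U \<Longrightarrow> u * b - b \<in> J" "\<And>u. u \<in> U \<Longrightarrow> b * u - b \<in> J"
    "\<And>r x. r \<in> R \<Longrightarrow> b \<in> rad r \<Longrightarrow> int p dvd r x"
proof -
  define stab where "stab b \<longleftrightarrow> (\<forall>u\<in>U. u * b - b \<in> J \<and> b * u - b \<in> J)" for b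
  define N where "N b = {r \<in> R. b \<in> rad r}" for b
  obtain b where b: "stab b" and min: "\<And>b'. stab b' \<Longrightarrow> card (N b) \<le> card (N b')"
    using ex_has_least_nat[of stab 0 "\<lambda>b. card (N b)"] J_zero by (auto simp: stab_def)
  have "int p dvd r x" if r: "r \<in> R" and br: "b \<in> rad r" for r x
  proof (rule ccontr)
    assume "\<not> int p dvd r x"
    then obtain c0 where c0: "c0 \<notin> rad r"
      and c0U: "\<And>u. u \<in> U \<Longrightarrow> u * c0 - c0 \<in> rad r \<and> c0 * u - c0 \<in> rad r"
      using fixpt[OF r] by blast
    obtain t where t1: "t - 1 \<in> rad r" and tJ: "\<And>y. y \<in> rad r \<Longrightarrow> t * y \<in> J"
      using exists_complement[OF r] by blast
    \<comment> \<open>Multiplication by \<open>t\<close> turns invariance modulo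
      \<open>rad r\<close> into invariance modulo \<open>J\<close>, while \<open>c0\<close> is
      unchanged modulo \<open>rad r\<close>.\<close>
    define c where "c = t * c0"
    have cQ: "c * y \<in> J" if "y \<in> rad r" for y
      using tJ[OF rad_mult_left[OF r that, of c0]] by (simp add: c_def mult.assoc)
    have c_rad: "c \<notin> rad r"
    proof
      assume "c \<in> rad r"
      moreover have "(t - 1) * c0 \<in> rad r" using t1 by (rule rad_mult_right)
      ultimately have "c - (t - 1) * c0 \<in> rad r" by (rule rad_diff[OF r])
      then show False using c0 by (simp add: c_def algebra_simps)
    qed
    \<comment> \<open>Centrality of \<open>t\<close> modulo \<open>J\<close>: the commutator lies in
      \<open>rad r\<close> and also annihilates \<open>rad r\<close> modulo \<open>J\<close>, so it
      generates a right ideal of elements of square zero.\<close>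
    have comm: "u * t - t * u \<in> J" for u
    proof (rule mem_J_if_nilpotent)
      fix x
      let ?w = "u * t - t * u"
      have "?w = u * (t - 1) - (t - 1) * u" by (simp add: algebra_simps)
      then have wQ: "?w \<in> rad r"
        using rad_diff[OF r rad_mult_left[OF r t1] rad_mult_right[OF t1]] by simp
      have wJ: "?w * y \<in> J" if "y \<in> rad r" for y
      proof -
        have "?w * y = u * (t * y) - t * (u * y)" by (simp add: algebra_simps)
        then show ?thesis
          using J_diff[OF J_mult_left[OF tJ[OF that]] tJ[OF rad_mult_left[OF r that]]] by simp
      qed
      have "(?w * x) ^ 2 = ?w * (x * ?w * x)" by (simp add: power2_eq_square mult.assoc)
      then show "(?w * x) ^ 2 \<in> J"
        using wJ[OF rad_mult_right[OF rad_mult_left[OF r wQ]]] by simp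
    qed
    have stabc: "stab c"
      unfolding stab_def
    proof (intro ballI conjI)
      fix u assume u: "u \<in> U"
      have "u * c - c = (u * t - t * u) * c0 + t * (u * c0 - c0)" by (simp add: c_def algebra_simps)
      then show "u * c - c \<in> J" using J_add[OF J_mult_right[OF comm] tJ] c0U[OF u] by simp
      have "c * u - c = t * (c0 * u - c0)" by (simp add: c_def algebra_simps)
      then show "c * u - c \<in> J" using tJ c0U[OF u] by simp
    qed
    have "stab (b + c)"
      unfolding stab_def
    proof (intro ballI conjI)
      fix u assume u: "u \<in> U"
      have eq: "u * (b + c) - (b + c) = (u * b - b) + (u * c - c)"
        "(b + c) * u - (b + c) = (b * u - b) + (c * u - c)" by (simp_all add: algebra_simps)
      show "u * (b + c) - (b + c) \<in> J" "(b + c) * u - (b + c) \<in> J"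
        unfolding eq using b stabc u J_add by (auto simp: stab_def)
    qed
    moreover have "N (b + c) \<subset> N b"
    proof
      show "N (b + c) \<subseteq> N b"
      proof
        fix r' assume "r' \<in> N (b + c)"
        then have r': "r' \<in> R" "b + c \<in> rad r'" by (auto simp: N_def)
        \<comment> \<open>On \<open>rad r\<close> the summand \<open>c\<close> is invisible, so
          \<open>b\<close> inherits the vanishing from \<open>b + c\<close>.\<close>
        have bQ: "int p dvd r' (b * y)" if "y \<in> rad r" for y
        proof -
          have "r' (b * y) = r' ((b + c) * y) - r' (c * y)"
            by (simp add: distrib_right additive[OF r'(1)])
          moreover have "int p dvd r' ((b + c) * y)" using r'(2) by (simp add: rad_def)
          moreover have "int p dvd r' (c * y)" using rad_dvd[OF J_rad[OF cQ[OF that] r'(1)]] .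
          ultimately show ?thesis by simp
        qed
        have "int p dvd r' (b * z)" for z
        proof -
          \<comment> \<open>Since \<open>q \<ge> 2\<close>, the power \<open>(b * z) ^ q\<close>
            contains a second factor \<open>b\<close>; it is thus \<open>b\<close> times an element
            of \<open>rad r\<close>, and \<open>frobenius\<close> returns to
            \<open>b * z\<close>.\<close>
          obtain j where j: "q = 2 + j" using le_Suc_ex[of 2 q] q_gt_1 by auto
          have "(b * z) ^ q = b * (z * (b * (z * (b * z) ^ j)))" by (simp add: j power_add power2_eq_square mult.assoc)
          moreover have "z * (b * (z * (b * z) ^ j)) \<in> rad r"
            using rad_mult_left[OF r rad_mult_right[OF br]] .
          ultimately have "int p dvd r' ((b * z) ^ q)" using bQ by simp
          then show ?thesis using frobenius[OF r'(1)] cong_dvd_iff by blast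
        qed
        then show "r' \<in> N b" using r' by (auto simp: N_def rad_def)
      qed
      have "r \<notin> N (b + c)"
      proof
        assume "r \<in> N (b + c)"
        then have "(b + c) - b \<in> rad r" by (intro rad_diff[OF r _ br]) (simp add: N_def)
        then show False using c_rad by simp
      qed
      moreover have "r \<in> N b" using r br by (simp add: N_def)
      ultimately show "N (b + c) \<noteq> N b" by blast
    qed
    then have "card (N (b + c)) < card (N b)"
      using fin_R by (intro psubset_card_mono) (auto simp: N_def)
    ultimately show False using min[of "b + c"] by simp
  qed
  then show thesis using that b by (auto simp: stab_def)
qed

end

section \<open>Linear forms on the monoid ring of words over a group\<close>

text \<open>A group given by a carrier set has no group ring in the type-class hierarchy.  The monoid ring
  of the words over \<open>'a\<close>, each evaluated in \<open>G\<close> by \<open>ev\<close>, replaces it: the difference of a word and its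
  value lies in the radical of every form \<open>lin s\<close>.\<close>

datatype 'a word = Word (letters: "'a list")

instantiation word :: (type) monoid_add
begin

definition zero_word :: "'a word" where "zero_word = Word []"

definition plus_word :: "'a word \<Rightarrow> 'a word \<Rightarrow> 'a word" where
  "plus_word v w = Word (letters v @ letters w)"

instance by standard (simp_all add: zero_word_def plus_word_def)

end

text \<open>Fermat's congruence, read off from \<open>trace_power_sum_cong\<close> for a sum of
  \<open>m\<close> ones with the identity as trace form.\<close>

lemma int_power_prime_power_cong:
  assumes "Factorial_Ring.prime p"
  shows "[(c::int) ^ (p ^ n) = c] (mod int p)"
proof -
  define m where "m = nat (c mod int p)"
  have p0: "p > 0" using assms by (simp add: prime_gt_0_nat)
  have m: "[c = int m] (mod int p)" using p0 by (simp add: m_def cong_def)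
  have "[id ((\<Sum>i<m. 1 :: int) ^ (p ^ n)) = (\<Sum>i<m. id (1 ^ (p ^ n)))] (mod int p)"
    by (rule trace_power_sum_cong[OF assms]) (auto simp: mult.commute)
  then have "[int m ^ (p ^ n) = int m] (mod int p)" by simp
  then show ?thesis using m by (meson cong_pow cong_sym cong_trans)
qed

lemma mod_shift: "(a + (h + k) mod m * b) mod m = ((a + k * b) mod m + h * b) mod m" for a b h k m :: int
proof -
  have "(a + (h + k) mod m * b) mod m = (a + (h + k) * b) mod m"
    by (metis mod_add_right_eq mod_mult_left_eq)
  also have "a + (h + k) * b = (a + k * b) + h * b" by (simp only: distrib_right add_ac)
  finally show ?thesis by (simp only: mod_add_left_eq)
qed

context group
begin

text \<open>Letters outside the carrier count as \<open>\<one>\<close>, so that \<open>ev\<close> is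
  a homomorphism into the group on all words.\<close>

definition ev :: "'a word \<Rightarrow> 'a" where
  "ev w = foldr (\<lambda>x y. (if x \<in> carrier G then x else \<one>) \<otimes> y) (letters w) \<one>"

abbreviation gen :: "'a \<Rightarrow> 'a word \<Rightarrow>\<^sub>0 int" where
  "gen x \<equiv> frag_of (Word [x])"

definition lin :: "('a \<Rightarrow> int) \<Rightarrow> ('a word \<Rightarrow>\<^sub>0 int) \<Rightarrow> int" where
  "lin s a = (\<Sum>w\<in>Poly_Mapping.keys a. Poly_Mapping.lookup a w * s (ev w))"

lemma ev_closed [simp]: "ev w \<in> carrier G"
proof -
  have "foldr (\<lambda>x y. (if x \<in> carrier G then x else \<one>) \<otimes> y) xs \<one> \<in> carrier G" for xs
    by (induction xs) auto
  then show ?thesis by (simp add: ev_def)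
qed

lemma ev_zero [simp]: "ev 0 = \<one>"
  by (simp add: ev_def zero_word_def)

lemma ev_add: "ev (v + w) = ev v \<otimes> ev w"
proof -
  let ?f = "\<lambda>xs. foldr (\<lambda>x y. (if x \<in> carrier G then x else \<one>) \<otimes> y) xs \<one>"
  have cl: "?f xs \<in> carrier G" for xs using ev_closed[of "Word xs"] by (simp add: ev_def)
  have "?f (xs @ ys) = ?f xs \<otimes> ?f ys" for xs ys
  proof (induction xs)
    case Nil
    then show ?case using cl by simp
  next
    case (Cons x xs)
    then show ?case using cl by (simp add: m_assoc)
  qed
  then show ?thesis by (simp add: ev_def plus_word_def)
qed

lemma ev_letter [simp]: "x \<in> carrier G \<Longrightarrow> ev (Word [x]) = x"
  by (simp add: ev_def)

lemma lin_alt: "finite A \<Longrightarrow> Poly_Mapping.keys a \<subseteq> A \<Longrightarrow>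
    lin s a = (\<Sum>w\<in>A. Poly_Mapping.lookup a w * s (ev w))"
  unfolding lin_def by (rule sum.mono_neutral_left) (auto simp: in_keys_iff)

lemma lin_add: "lin s (a + b) = lin s a + lin s b"
proof -
  let ?A = "Poly_Mapping.keys a \<union> Poly_Mapping.keys b"
  have "Poly_Mapping.keys (a + b) \<subseteq> ?A" by (rule Poly_Mapping.keys_add)
  then show ?thesis
    by (simp add: lin_alt[of ?A] Poly_Mapping.lookup_add distrib_right sum.distrib)
qed

lemma lin_zero [simp]: "lin s 0 = 0"
  by (simp add: lin_def)

lemma lin_diff: "lin s (a - b) = lin s a - lin s b"
  using lin_add[of s "a - b" b] by simp

lemma lin_single: "lin s (Poly_Mapping.single w c) = c * s (ev w)"
  by (subst lin_alt[of "{w}"]) (auto simp: lookup_single_not_eq)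

lemma lin_frag_of [simp]: "lin s (frag_of w) = s (ev w)"
  by (simp add: lin_single)

lemma lin_sum: "lin s (sum f A) = (\<Sum>i\<in>A. lin s (f i))"
  by (induction A rule: infinite_finite_induct) (auto simp: lin_add)

lemma lin_of_nat_mult: "lin s (of_nat k * a) = int k * lin s a"
  by (induction k) (auto simp: distrib_right lin_add)

lemma lin_diff_fun: "lin (\<lambda>x\<in>carrier G. s x - s' x) a = lin s a - lin s' a"
  by (simp add: lin_def right_diff_distrib sum_subtractf)

lemma frag_of_mult: "frag_of v * frag_of w = frag_of (v + w)"
  by (simp add: mult_single)

text \<open>A form \<open>lin s\<close> sees words only through the multiplicative map
  \<open>ev\<close>, so tests against words reduce to tests against group elements.\<close>

lemma lin_mult_frag_of: "lin s (a * frag_of w) = lin s (a * gen (ev w))"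
  using subset_UNIV by (induction a rule: frag_induction)
    (auto simp: left_diff_distrib lin_diff frag_of_mult ev_add)

lemma lin_mult_gen: "\<lbrakk>x \<in> carrier G; y \<in> carrier G\<rbrakk> \<Longrightarrow>
    lin s (a * gen (x \<otimes> y)) = lin s (a * gen x * gen y)"
  using lin_mult_frag_of[of s a "Word [x] + Word [y]"]
  by (simp add: mult.assoc frag_of_mult ev_add)

lemma lin_commute:
  assumes "\<And>x y. x \<in> carrier G \<Longrightarrow> y \<in> carrier G \<Longrightarrow> s (x \<otimes> y) = s (y \<otimes> x)"
  shows "lin s (a * b) = lin s (b * a)"
  using subset_UNIV
proof (induction a rule: frag_induction)
  case (one v)
  show ?case
    using subset_UNIV by (induction b rule: frag_induction)
      (auto simp: right_diff_distrib left_diff_distrib lin_diff frag_of_mult ev_add assms)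
qed (auto simp: right_diff_distrib left_diff_distrib lin_diff)

lemma dvd_lin_mult:
  assumes "\<And>x. x \<in> carrier G \<Longrightarrow> k dvd lin s (a * gen x)"
  shows "k dvd lin s (a * b)"
  using subset_UNIV
proof (induction b rule: frag_induction)
  case (one w)
  show ?case unfolding lin_mult_frag_of[of s a w] by (rule assms) simp
qed (auto simp: right_diff_distrib lin_diff)

text \<open>By \<open>trace_power_sum_cong\<close> it suffices to treat monomials; there Fermat's
  congruence handles the coefficient and \<open>pow\<close> the group element.\<close>

lemma lin_frobenius:
  assumes p: "Factorial_Ring.prime p"
    and comm: "\<And>x y. x \<in> carrier G \<Longrightarrow> y \<in> carrier G \<Longrightarrow> s (x \<otimes> y) = s (y \<otimes> x)"
    and pow: "\<And>x. x \<in> carrier G \<Longrightarrow> s (x [^] (p ^ n)) = s x"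
  shows "[lin s (a ^ (p ^ n)) = lin s a] (mod int p)"
proof -
  let ?K = "Poly_Mapping.keys a" and ?c = "Poly_Mapping.lookup a"
  have a: "a = (\<Sum>w\<in>?K. Poly_Mapping.single w (?c w))"
    by (rule poly_mapping_eqI) (auto simp: lookup_sum lookup_single when_def in_keys_iff)
  have single_power: "\<exists>v. Poly_Mapping.single w c ^ k = Poly_Mapping.single v (c ^ k) \<and> ev v = ev w [^] k"
    for w c and k :: nat
  proof (induction k)
    case 0
    show ?case by (rule exI[of _ 0]) simp
  next
    case (Suc k)
    then obtain v where "Poly_Mapping.single w c ^ k = Poly_Mapping.single v (c ^ k)"
      "ev v = ev w [^] k" by blast
    then show ?case
      by (intro exI[of _ "v + w"]) (simp add: power_Suc2 mult_single ev_add mult.commute del: power_Suc)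
  qed
  have single: "[lin s (Poly_Mapping.single w c ^ (p ^ n)) = lin s (Poly_Mapping.single w c)] (mod int p)" for w c
  proof -
    obtain v where "Poly_Mapping.single w c ^ (p ^ n) = Poly_Mapping.single v (c ^ (p ^ n))"
      "ev v = ev w [^] (p ^ n)" using single_power by blast
    then show ?thesis
      using cong_scalar_right[OF int_power_prime_power_cong[OF p, of c n], of "s (ev w)"]
      by (simp add: lin_single pow)
  qed
  have lc: "lin s (x * y) = lin s (y * x)" for x y by (intro lin_commute comm)
  have "lin s (a ^ (p ^ n)) = lin s ((\<Sum>w\<in>?K. Poly_Mapping.single w (?c w)) ^ (p ^ n))"
    by (rule arg_cong[OF a])
  also have "[\<dots> = (\<Sum>w\<in>?K. lin s (Poly_Mapping.single w (?c w) ^ (p ^ n)))] (mod int p)"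
    by (rule trace_power_sum_cong[OF p finite_keys lin_add lc])
  also have "[(\<Sum>w\<in>?K. lin s (Poly_Mapping.single w (?c w) ^ (p ^ n)))
      = (\<Sum>w\<in>?K. lin s (Poly_Mapping.single w (?c w)))] (mod int p)"
    by (rule cong_sum) (rule single)
  also have "(\<Sum>w\<in>?K. lin s (Poly_Mapping.single w (?c w))) = lin s a"
    using arg_cong[OF a, of "lin s"] by (simp only: lin_sum)
  finally show ?thesis .
qed

section \<open>Elements fixed by a p-subgroup modulo the radical of one form\<close>

text \<open>The quotient by the radical of \<open>lin s\<close> is modelled by the finite set
  \<open>Fs\<close> of functions on the group. Its size is divisible by \<open>p\<close>, and
  passing to the fixed points of right and then of left translation by \<open>P\<close> preserves
  this. The zero function is one fixed point, so there is another.\<close>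

lemma exists_fixed_form:
  assumes p: "Factorial_Ring.prime p" and fin: "finite (carrier G)"
    and P: "subgroup P G" "card P = p ^ e"
    and comm: "\<And>x y. x \<in> carrier G \<Longrightarrow> y \<in> carrier G \<Longrightarrow> s (x \<otimes> y) = s (y \<otimes> x)"
    and nz: "\<not> int p dvd lin s a"
  obtains c where "\<not> (\<forall>x. int p dvd lin s (c * x))"
    "\<And>u x. u \<in> P \<Longrightarrow> int p dvd lin s ((gen u * c - c) * x)"
    "\<And>u x. u \<in> P \<Longrightarrow> int p dvd lin s ((c * gen u - c) * x)"
proof -
  have p1: "p > 1" using p by (rule prime_gt_1_nat)
  have PG: "u \<in> carrier G" if "u \<in> P" for u using subgroup.mem_carrier[OF P(1) that] .
  have lc: "lin s (x * y) = lin s (y * x)" for x y by (intro lin_commute comm)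
  define \<phi> where "\<phi> c = (\<lambda>x\<in>carrier G. lin s (c * gen x) mod int p)" for c
  define Fs where "Fs = range \<phi>"
  have finX: "finite Fs"
  proof (rule finite_subset)
    show "Fs \<subseteq> carrier G \<rightarrow>\<^sub>E {0..<int p}" using p1 by (auto simp: Fs_def \<phi>_def)
  qed (use fin in \<open>auto intro: finite_PiE\<close>)
  interpret H: group "G\<lparr>carrier := P\<rparr>" by (rule subgroup.subgroup_is_group[OF P(1) is_group])
  \<comment> \<open>By the trace property, right translation of the function is left multiplication
    of the ring element.\<close>
  have right: "(\<lambda>x\<in>carrier G. \<phi> c (x \<otimes> u)) = \<phi> (gen u * c)" if "u \<in> carrier G" for c u
  proof
    fix x
    have "lin s (c * gen x * gen u) = lin s (gen u * c * gen x)"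
      using lc[of "c * gen x" "gen u"] by (simp add: mult.assoc)
    then show "(\<lambda>x\<in>carrier G. \<phi> c (x \<otimes> u)) x = \<phi> (gen u * c) x"
      using that by (simp add: \<phi>_def lin_mult_gen)
  qed
  have left: "(\<lambda>x\<in>carrier G. \<phi> c (u \<otimes> x)) = \<phi> (c * gen u)" if "u \<in> carrier G" for c u
    using that by (auto simp: \<phi>_def lin_mult_gen fun_eq_iff)
  \<comment> \<open>This replaces a count of vectors: \<open>\<phi> 1\<close> is nonzero because of
    \<open>nz\<close>, so adding its multiples moves every function, and \<open>p\<close> divides
    \<open>card Fs\<close>.\<close>
  interpret shift: p_group_action "integer_mod_group p" Fs
    "\<lambda>k f. \<lambda>x\<in>carrier G. (f x + k * \<phi> 1 x) mod int p" p 1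
  proof (intro p_group_action.intro p_group_action_axioms.intro)
    fix k f assume k: "k \<in> carrier (integer_mod_group p)" and f: "f \<in> Fs"
    obtain j where j: "k = int j" using k p1 by (auto simp: carrier_integer_mod_group dest: nonneg_int_cases)
    obtain c where c: "f = \<phi> c" using f by (auto simp: Fs_def)
    have "(f x + k * \<phi> 1 x) mod int p = \<phi> (c + of_nat j) x" if "x \<in> carrier G" for x
      using that by (simp add: c j \<phi>_def distrib_right lin_add lin_of_nat_mult)
        (metis mod_add_eq mod_mult_right_eq mod_add_left_eq)
    then have "(\<lambda>x\<in>carrier G. (f x + k * \<phi> 1 x) mod int p) = \<phi> (c + of_nat j)"
      by (auto simp: fun_eq_iff \<phi>_def)
    then show "(\<lambda>x\<in>carrier G. (f x + k * \<phi> 1 x) mod int p) \<in> Fs" by (auto simp: Fs_def)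
  next
    fix h k f assume "f \<in> Fs"
    have "(f x + (h + k) mod int p * \<phi> 1 x) mod int p
        = ((f x + k * \<phi> 1 x) mod int p + h * \<phi> 1 x) mod int p" for x
      by (rule mod_shift)
    then show "(\<lambda>x\<in>carrier G. (f x + (h \<otimes>\<^bsub>integer_mod_group p\<^esub> k) * \<phi> 1 x) mod int p) =
        (\<lambda>x\<in>carrier G. ((\<lambda>x\<in>carrier G. (f x + k * \<phi> 1 x) mod int p) x + h * \<phi> 1 x) mod int p)"
      by (auto simp: fun_eq_iff)
  next
    fix f assume "f \<in> Fs"
    then show "(\<lambda>x\<in>carrier G. (f x + \<one>\<^bsub>integer_mod_group p\<^esub> * \<phi> 1 x) mod int p) = f"
      by (auto simp: Fs_def \<phi>_def fun_eq_iff)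
  qed (use p p1 finX in \<open>auto simp: carrier_integer_mod_group\<close>)
  have "shift.fixed = {}"
  proof (rule ccontr)
    assume "shift.fixed \<noteq> {}"
    then obtain f where f: "f \<in> Fs" "\<And>k. k \<in> carrier (integer_mod_group p) \<Longrightarrow>
        (\<lambda>x\<in>carrier G. (f x + k * \<phi> 1 x) mod int p) = f"
      unfolding shift.fixed_def by blast
    have step: "(\<lambda>x\<in>carrier G. (f x + 1 * \<phi> 1 x) mod int p) = f"
      using p1 by (intro f) auto
    have "[f x + \<phi> 1 x = f x] (mod int p)" if "x \<in> carrier G" for x
    proof -
      have "f x mod int p = f x" using f(1) that by (auto simp: Fs_def \<phi>_def)
      then show ?thesis using fun_cong[OF step, of x] that by (simp add: cong_def)
    qed
    then have "int p dvd \<phi> 1 x" if "x \<in> carrier G" for x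
      using that by (simp add: cong_iff_dvd_diff)
    then have "int p dvd lin s (1 * gen x)" if "x \<in> carrier G" for x
      using that by (auto simp: \<phi>_def dvd_mod_iff)
    then have "int p dvd lin s (1 * a)" by (rule dvd_lin_mult)
    then show False using nz by simp
  qed
  then have cardX: "[card Fs = 0] (mod p)" using shift.card_cong_fixed by simp
  interpret R: p_group_action "G\<lparr>carrier := P\<rparr>" Fs "\<lambda>u f. \<lambda>x\<in>carrier G. f (x \<otimes> u)" p e
  proof (intro p_group_action.intro p_group_action_axioms.intro)
    fix u f assume "u \<in> carrier (G\<lparr>carrier := P\<rparr>)" and "f \<in> Fs"
    then show "(\<lambda>x\<in>carrier G. f (x \<otimes> u)) \<in> Fs" using right PG by (auto simp: Fs_def)
  qed (use p P finX PG in \<open>auto simp: Fs_def \<phi>_def fun_eq_iff m_assoc H.is_group\<close>)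
  have restrict_eq: "restrict g (carrier G) = f \<longleftrightarrow> (\<forall>x\<in>carrier G. g x = f x)" if "f \<in> Fs" for f g
    using that by (auto simp: Fs_def \<phi>_def restrict_def fun_eq_iff)
  define Rs where "Rs = {f \<in> Fs. \<forall>v\<in>P. \<forall>x\<in>carrier G. f (x \<otimes> v) = f x}"
  have Rfix: "R.fixed = Rs"
    unfolding R.fixed_def Rs_def by (auto simp: restrict_eq)
  have fixX: "Rs \<subseteq> Fs" by (auto simp: Rs_def)
  \<comment> \<open>Left and right translations commute, so the left ones act on the set
    \<open>Rs\<close> of right-invariant functions.\<close>
  interpret L: p_group_action "G\<lparr>carrier := P\<rparr>" Rs "\<lambda>u f. \<lambda>x\<in>carrier G. f (inv u \<otimes> x)" p e
  proof (intro p_group_action.intro p_group_action_axioms.intro)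
    fix u f assume u: "u \<in> carrier (G\<lparr>carrier := P\<rparr>)" and f: "f \<in> Rs"
    have "(\<lambda>x\<in>carrier G. f (inv u \<otimes> x)) \<in> Fs" using left u f fixX PG by (auto simp: Fs_def)
    moreover have "f (inv u \<otimes> (x \<otimes> v)) = f (inv u \<otimes> x)" if "v \<in> P" "x \<in> carrier G" for v x
    proof -
      have "f (inv u \<otimes> x \<otimes> v) = f (inv u \<otimes> x)" using f that u PG unfolding Rs_def by auto
      then show ?thesis using that u PG by (simp add: m_assoc)
    qed
    ultimately show "(\<lambda>x\<in>carrier G. f (inv u \<otimes> x)) \<in> Rs"
      unfolding Rs_def using PG by auto
  next
    fix u v f assume "u \<in> carrier (G\<lparr>carrier := P\<rparr>)" "v \<in> carrier (G\<lparr>carrier := P\<rparr>)"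
    then show "(\<lambda>x\<in>carrier G. f (inv (u \<otimes>\<^bsub>G\<lparr>carrier := P\<rparr>\<^esub> v) \<otimes> x)) =
        (\<lambda>x\<in>carrier G. (\<lambda>x\<in>carrier G. f (inv v \<otimes> x)) (inv u \<otimes> x))"
      using PG by (intro restrict_ext) (simp add: inv_mult_group m_assoc)
  next
    fix f assume "f \<in> Rs"
    then show "(\<lambda>x\<in>carrier G. f (inv \<one>\<^bsub>G\<lparr>carrier := P\<rparr>\<^esub> \<otimes> x)) = f"
      using restrict_eq[of f] fixX by auto
  qed (use p P finite_subset[OF fixX finX] H.is_group in auto)
  define Ls where "Ls = {f \<in> Rs. \<forall>v\<in>P. \<forall>x\<in>carrier G. f (inv v \<otimes> x) = f x}"
  have Lfix: "L.fixed = Ls"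
    unfolding L.fixed_def Ls_def using fixX by (auto simp: restrict_eq)
  have "[card Ls = 0] (mod p)"
    using L.card_cong_fixed R.card_cong_fixed cardX unfolding Lfix Rfix by (meson cong_sym cong_trans)
  then have dvd: "p dvd card Ls" by (simp add: cong_0_iff)
  have \<phi>0: "\<phi> 0 x = 0" if "x \<in> carrier G" for x using that by (simp add: \<phi>_def)
  have inv0: "\<phi> 0 (x \<otimes> v) = \<phi> 0 x" "\<phi> 0 (inv v \<otimes> x) = \<phi> 0 x"
    if "v \<in> P" "x \<in> carrier G" for v x
    using that(2) PG[OF that(1)] by (simp_all only: \<phi>0 m_closed inv_closed)
  have "\<phi> 0 \<in> Fs" unfolding Fs_def by (rule rangeI)
  then have zero: "\<phi> 0 \<in> Ls" unfolding Ls_def Rs_def by (intro CollectI conjI ballI inv0)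
  have "Ls \<noteq> {\<phi> 0}" using dvd p1 by auto
  then obtain f where f: "f \<in> Ls" "f \<noteq> \<phi> 0" using zero by blast
  then have fF: "f \<in> Fs" by (auto simp: Ls_def Rs_def)
  then obtain c where c: "f = \<phi> c" by (auto simp: Fs_def)
  have Lf: "(\<lambda>x\<in>carrier G. f (inv u \<otimes> x)) = f" if "u \<in> P" for u
    unfolding restrict_eq[OF fF] using f(1) that by (simp add: Ls_def)
  have Rf: "(\<lambda>x\<in>carrier G. f (x \<otimes> u)) = f" if "u \<in> P" for u
    unfolding restrict_eq[OF fF] using f(1) that by (simp add: Ls_def Rs_def)
  have eq: "int p dvd lin s ((c1 - c2) * x)" if "\<phi> c1 = \<phi> c2" for c1 c2 x
  proof (rule dvd_lin_mult)
    fix x assume "x \<in> carrier G"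
    then show "int p dvd lin s ((c1 - c2) * gen x)"
      using fun_cong[OF that, of x]
      by (simp add: \<phi>_def left_diff_distrib lin_diff mod_eq_dvd_iff)
  qed
  show thesis
  proof
    show "\<not> (\<forall>x. int p dvd lin s (c * x))"
      using f(2) by (auto simp: c \<phi>_def fun_eq_iff dvd_eq_mod_eq_0)
    fix u x assume u: "u \<in> P"
    have "\<phi> (gen u * c) = \<phi> c" using Rf[OF u] right[OF PG[OF u]] c by simp
    then show "int p dvd lin s ((gen u * c - c) * x)" by (rule eq)
    have iu: "inv u \<in> P" using u P(1) by (simp add: subgroup.m_inv_closed)
    have "\<phi> (c * gen u) = \<phi> c" using Lf[OF iu] left[OF PG[OF u]] c PG[OF u] by simp
    then show "int p dvd lin s ((c * gen u - c) * x)" by (rule eq)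
  qed
qed

end

section \<open>Trace functions and double cosets\<close>

context group
begin

text \<open>The orbits correspond to the double cosets \<open>P x P\<close>; the inverse turns right
  multiplication into a left action.\<close>

lemma right_coset_action:
  assumes "finite (carrier G)" "Factorial_Ring.prime p" "subgroup P G" "card P = p ^ e"
  shows "p_group_action (G\<lparr>carrier := P\<rparr>) (rcosets P) (\<lambda>u C. C #> inv u) p e"
proof -
  interpret P: subgroup P G by fact
  interpret H: group "G\<lparr>carrier := P\<rparr>" by (rule P.subgroup_is_group[OF is_group])
  have sub: "C \<subseteq> carrier G" if "C \<in> rcosets P" for C
    using that rcosets_part_G[OF assms(3)] by blast
  show ?thesis
  proof (intro p_group_action.intro p_group_action_axioms.intro)
    show "finite (rcosets P)" using assms(1) by (simp add: RCOSETS_def)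
  next
    fix u C assume "u \<in> carrier (G\<lparr>carrier := P\<rparr>)" "C \<in> rcosets P"
    then show "C #> inv u \<in> rcosets P"
      by (auto simp: RCOSETS_def coset_mult_assoc P.subset)
  next
    fix u v C assume "u \<in> carrier (G\<lparr>carrier := P\<rparr>)" "v \<in> carrier (G\<lparr>carrier := P\<rparr>)" "C \<in> rcosets P"
    then show "C #> inv (u \<otimes>\<^bsub>G\<lparr>carrier := P\<rparr>\<^esub> v) = C #> inv v #> inv u"
      using sub by (simp add: inv_mult_group coset_mult_assoc)
  qed (use assms sub H.is_group in auto)
qed

lemma rcoset_mult_eq_iff:
  assumes "subgroup P G" "g \<in> carrier G" "u \<in> carrier G"
  shows "P #> (g \<otimes> u) = P #> g \<longleftrightarrow> g \<otimes> u \<otimes> inv g \<in> P"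
proof
  assume "P #> (g \<otimes> u) = P #> g"
  then have "P #> (g \<otimes> u \<otimes> inv g) = P"
    using assms by (intro coset_mult_inv2) (auto simp: subgroup.subset)
  then show "g \<otimes> u \<otimes> inv g \<in> P" by (rule coset_join1) (use assms in auto)
next
  assume "g \<otimes> u \<otimes> inv g \<in> P"
  then have "P #> (g \<otimes> u \<otimes> inv g) = P" by (intro coset_join2[OF _ assms(1)]) (use assms in auto)
  then show "P #> (g \<otimes> u) = P #> g"
    using assms by (intro coset_mult_inv1) (auto simp: subgroup.subset)
qed

definition trace_functions :: "int set \<Rightarrow> nat \<Rightarrow> ('a \<Rightarrow> int) set" where
  "trace_functions M q = {s \<in> carrier G \<rightarrow>\<^sub>E M.
     (\<forall>x\<in>carrier G. \<forall>y\<in>carrier G. s (x \<otimes> y) = s (y \<otimes> x)) \<and> (\<forall>x\<in>carrier G. s (x [^] q) = s x)}"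

text \<open>With the element \<open>b\<close> from \<open>exists_invariant\<close>, a function
  \<open>s\<close> is encoded by the residues of \<open>lin s (b * gen x)\<close>. They are constant
  on double cosets, and by the choice of \<open>b\<close> they determine \<open>s\<close>.\<close>

lemma card_trace_functions_le:
  assumes fin: "finite (carrier G)" and p: "Factorial_Ring.prime p"
    and P: "subgroup P G" "card P = p ^ e" and n: "n > 0"
  shows "card (trace_functions {0..<int p} (p ^ n))
    \<le> p ^ card (p_group_action.orb (G\<lparr>carrier := P\<rparr>) (\<lambda>u C. C #> inv u) ` (rcosets P))"
proof -
  let ?q = "p ^ n"
  interpret A: p_group_action "G\<lparr>carrier := P\<rparr>" "rcosets P" "\<lambda>u C. C #> inv u" p e
    by (rule right_coset_action[OF fin p P])
  have p1: "p > 1" using p by (rule prime_gt_1_nat)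
  have PG: "u \<in> carrier G" if "u \<in> P" for u using subgroup.mem_carrier[OF P(1) that] .
  have Psub: "P \<subseteq> carrier G" using PG by blast
  define S where "S = trace_functions {- int p<..<int p} ?q"
  define S0 where "S0 = trace_functions {0..<int p} ?q"
  have S0S: "S0 \<subseteq> S" using p1 by (auto simp: S0_def S_def trace_functions_def PiE_iff) 
  have finS: "finite S"
    using finite_PiE[OF fin, of "\<lambda>_. {- int p<..<int p}"] by (auto simp: S_def trace_functions_def)
  have comm: "s (x \<otimes> y) = s (y \<otimes> x)" if "s \<in> S" "x \<in> carrier G" "y \<in> carrier G" for s x y
    using that by (simp add: S_def trace_functions_def)
  have pow: "s (x [^] ?q) = s x" if "s \<in> S" "x \<in> carrier G" for s x
    using that by (simp add: S_def trace_functions_def)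
  have lc: "lin s (a * c) = lin s (c * a)" if "s \<in> S" for s a c
    by (intro lin_commute comm that)
  \<comment> \<open>All forms are evaluated against all group elements at once, which determines an
    element modulo the common radical.\<close>
  define F where "F a = (\<lambda>(s, g)\<in>S \<times> carrier G. lin s (a * gen g) mod int p)" for a
  interpret T: trace_forms "lin ` S" p ?q F
  proof
    show "?q > 1" using p1 n by (rule one_less_power)
    have "range F \<subseteq> S \<times> carrier G \<rightarrow>\<^sub>E {0..<int p}" using p1 by (auto simp: F_def)
    then show "finite (range F)"
      by (rule finite_subset) (use finS fin in \<open>auto intro: finite_PiE\<close>)
  next
    fix a c r x assume F: "F a = F c" and "r \<in> lin ` S"
    then obtain s where s: "s \<in> S" "r = lin s" by blast
    have "int p dvd lin s ((a - c) * x)"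
    proof (rule dvd_lin_mult)
      fix g assume "g \<in> carrier G"
      then show "int p dvd lin s ((a - c) * gen g)"
        using fun_cong[OF F, of "(s, g)"] s(1)
        by (simp add: F_def left_diff_distrib lin_diff mod_eq_dvd_iff)
    qed
    then show "[r (a * x) = r (c * x)] (mod int p)"
      by (simp add: s cong_iff_dvd_diff left_diff_distrib lin_diff)
  next
    fix r x assume "r \<in> lin ` S"
    then show "[r (x ^ ?q) = r x] (mod int p)"
      using lin_frobenius[OF p] comm pow by blast
  qed (use finS lc in \<open>auto simp: lin_add\<close>)
  have "\<exists>c. c \<notin> T.rad r \<and> (\<forall>u\<in>gen ` P. u * c - c \<in> T.rad r \<and> c * u - c \<in> T.rad r)"
    if r: "r \<in> lin ` S" and nz: "\<exists>x. \<not> int p dvd r x" for r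
  proof -
    obtain s a where s: "s \<in> S" "r = lin s" and a: "\<not> int p dvd lin s a" using r nz by blast
    obtain c where "\<not> (\<forall>x. int p dvd lin s (c * x))"
      "\<And>u x. u \<in> P \<Longrightarrow> int p dvd lin s ((gen u * c - c) * x)"
      "\<And>u x. u \<in> P \<Longrightarrow> int p dvd lin s ((c * gen u - c) * x)"
      by (rule exists_fixed_form[OF p fin P comm[OF s(1)] a]) (use that in blast)+
    then show ?thesis unfolding T.rad_def s(2) by blast
  qed
  then obtain b where b1: "\<And>u. u \<in> gen ` P \<Longrightarrow> u * b - b \<in> T.J"
    and b2: "\<And>u. u \<in> gen ` P \<Longrightarrow> b * u - b \<in> T.J"
    and b3: "\<And>r x. r \<in> lin ` S \<Longrightarrow> b \<in> T.rad r \<Longrightarrow> int p dvd r x"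
    using T.exists_invariant[of "gen ` P"] by blast
  define val where "val s x = lin s (b * gen x) mod int p" for s x
  have JD: "lin s (a * x) mod int p = lin s (c * x) mod int p" if "a - c \<in> T.J" "s \<in> S" for a c s x
    using that by (auto simp: T.J_def T.rad_def mod_eq_dvd_iff left_diff_distrib lin_diff)
  have val_right: "val s (x \<otimes> u) = val s x" if "s \<in> S" "x \<in> carrier G" "u \<in> P" for s x u
  proof -
    have "lin s (b * gen (x \<otimes> u)) = lin s (gen u * b * gen x)"
      using that PG lc[of s "b * gen x" "gen u"] by (simp add: lin_mult_gen mult.assoc)
    then show ?thesis using JD[OF b1[OF imageI[OF that(3)]] that(1)] by (simp add: val_def)
  qed
  have val_left: "val s (u \<otimes> x) = val s x" if "s \<in> S" "x \<in> carrier G" "u \<in> P" for s x u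
    using that PG JD[OF b2[OF imageI[OF that(3)]] that(1)] by (simp add: val_def lin_mult_gen)
  define rep where "rep B = (SOME x. x \<in> carrier G \<and> P #> x \<in> B)" for B
  define \<Psi> where "\<Psi> s = (\<lambda>B\<in>A.orb ` (rcosets P). val s (rep B))" for s
  \<comment> \<open>The choice made by \<open>rep\<close> is harmless: the representative lies in
    \<open>P x P\<close>, where \<open>val s\<close> is constant.\<close>
  have \<Psi>: "\<Psi> s (A.orb (P #> x)) = val s x" if s: "s \<in> S" and x: "x \<in> carrier G" for s x
  proof -
    have E: "P #> x \<in> rcosets P" using x Psub by (simp add: rcosetsI)
    define y where "y = rep (A.orb (P #> x))"
    have "y \<in> carrier G \<and> P #> y \<in> A.orb (P #> x)"
      unfolding y_def rep_def by (rule someI[of _ x]) (use x A.mem_orb[OF E] in simp)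
    then obtain u where y: "y \<in> carrier G" and u: "u \<in> P" "P #> y = P #> x #> inv u"
      by (auto simp: A.orb_def)
    have iu: "inv u \<in> P" using u(1) P(1) by (simp add: subgroup.m_inv_closed)
    have "P #> y = P #> (x \<otimes> inv u)" using u x PG Psub by (simp add: coset_mult_assoc)
    then have "y \<in> P #> (x \<otimes> inv u)" using rcos_self[OF y P(1)] by simp
    then obtain v where v: "v \<in> P" "y = v \<otimes> (x \<otimes> inv u)" by (auto simp: r_coset_def)
    then have "val s y = val s x"
      using val_left[OF s, of "x \<otimes> inv u" v] val_right[OF s x iu] x PG[OF iu] by simp
    then show ?thesis using E by (simp add: \<Psi>_def y_def)
  qed
  have "inj_on \<Psi> S0"
  proof (rule inj_onI)
    fix s s' assume s: "s \<in> S0" "s' \<in> S0" and eq: "\<Psi> s = \<Psi> s'"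
    have sS: "s \<in> S" "s' \<in> S" using s S0S by auto
    \<comment> \<open>The difference lies in \<open>S\<close>, which is why the forms are taken from
      \<open>S\<close>; its form has \<open>b\<close> in the radical, hence vanishes modulo
      \<open>p\<close>, and residues in \<open>{0..<int p}\<close> congruent modulo \<open>p\<close>
      are equal.\<close>
    define d where "d = (\<lambda>x\<in>carrier G. s x - s' x)"
    have ran: "0 \<le> s x" "s x < int p" "0 \<le> s' x" "s' x < int p" if "x \<in> carrier G" for x
      using s that by (auto simp: S0_def trace_functions_def PiE_iff)
    have "d \<in> S"
      unfolding S_def trace_functions_def
    proof (intro CollectI conjI ballI)
      have "s x - s' x \<in> {- int p<..<int p}" if "x \<in> carrier G" for x using ran[OF that] by auto
      then show "d \<in> carrier G \<rightarrow>\<^sub>E {- int p<..<int p}" unfolding d_def by (intro restrict_PiE_iff[THEN iffD2] ballI)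
    next
      fix x y assume "x \<in> carrier G" "y \<in> carrier G"
      then show "d (x \<otimes> y) = d (y \<otimes> x)" by (simp add: d_def comm[OF sS(1), of x] comm[OF sS(2), of x])
    next
      fix x assume "x \<in> carrier G"
      then show "d (x [^] ?q) = d x" by (simp add: d_def pow[OF sS(1)] pow[OF sS(2)])
    qed
    have lin_d: "lin d a = lin s a - lin s' a" for a
      unfolding d_def by (rule lin_diff_fun)
    have "int p dvd lin d (b * x)" for x
    proof (rule dvd_lin_mult)
      fix x assume x: "x \<in> carrier G"
      have "val s x = val s' x" using \<Psi>[OF sS(1) x] \<Psi>[OF sS(2) x] eq by simp
      then show "int p dvd lin d (b * gen x)" by (simp add: lin_d val_def mod_eq_dvd_iff)
    qed
    then have "b \<in> T.rad (lin d)" unfolding T.rad_def by blast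
    then have dvd: "int p dvd lin d a" for a by (rule b3[OF imageI[OF \<open>d \<in> S\<close>]])
    have "s x = s' x" if x: "x \<in> carrier G" for x
    proof -
      have "int p dvd s x - s' x" using dvd[of "gen x"] x by (simp add: d_def)
      then have "s x mod int p = s' x mod int p" by (simp add: mod_eq_dvd_iff)
      then show ?thesis using ran[OF x] by simp
    qed
    then show "s = s'"
      using s by (intro PiE_ext[of _ "carrier G" "\<lambda>_. {0..<int p}"]) (auto simp: S0_def trace_functions_def)
  qed
  moreover have "\<Psi> ` S0 \<subseteq> A.orb ` (rcosets P) \<rightarrow>\<^sub>E {0..<int p}"
    using p1 by (auto simp: \<Psi>_def val_def)
  moreover have finO: "finite (A.orb ` (rcosets P))" using A.fin by simp
  ultimately have "card S0 \<le> card (A.orb ` (rcosets P) \<rightarrow>\<^sub>E {0..<int p})"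
    by (intro card_inj_on_le) (auto intro: finite_PiE)
  also have "\<dots> = p ^ card (A.orb ` (rcosets P))" using finO by (simp add: card_PiE)
  finally show ?thesis by (simp add: S0_def)
qed

section \<open>Classes of p-regular elements\<close>

lemma pow_conjugate:
  assumes "g \<in> carrier G" "x \<in> carrier G"
  shows "(g \<otimes> x \<otimes> inv g) [^] (k::nat) = g \<otimes> x [^] k \<otimes> inv g"
proof (induction k)
  case (Suc k)
  have "g \<otimes> x [^] k \<otimes> inv g \<otimes> (g \<otimes> x \<otimes> inv g) = g \<otimes> x [^] k \<otimes> (inv g \<otimes> g) \<otimes> x \<otimes> inv g"
    using assms by (simp only: m_assoc m_closed inv_closed nat_pow_closed)
  then show ?case using Suc assms by (simp add: m_assoc)
qed (use assms in simp)

lemma conj_class_conjugate: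
  assumes g: "g \<in> carrier G" and x: "x \<in> carrier G"
  shows "conj_class G (g \<otimes> x \<otimes> inv g) = conj_class G x"
proof (intro equalityI subsetI)
  fix y assume "y \<in> conj_class G (g \<otimes> x \<otimes> inv g)"
  then obtain h where h: "h \<in> carrier G" "y = h \<otimes> (g \<otimes> x \<otimes> inv g) \<otimes> inv h"
    by (auto simp: conj_class_def)
  then have "y = (h \<otimes> g) \<otimes> x \<otimes> inv (h \<otimes> g)"
    using g x by (simp add: inv_mult_group m_assoc)
  then show "y \<in> conj_class G x" using g h by (auto simp: conj_class_def)
next
  fix y assume "y \<in> conj_class G x"
  then obtain h where h: "h \<in> carrier G" "y = h \<otimes> x \<otimes> inv h" by (auto simp: conj_class_def)
  have "(h \<otimes> inv g) \<otimes> (g \<otimes> x \<otimes> inv g) \<otimes> inv (h \<otimes> inv g) = h \<otimes> (inv g \<otimes> g) \<otimes> x \<otimes> (inv g \<otimes> g) \<otimes> inv h"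
    using g x h(1) by (simp only: inv_mult_group inv_inv m_assoc m_closed inv_closed)
  then have "y = (h \<otimes> inv g) \<otimes> (g \<otimes> x \<otimes> inv g) \<otimes> inv (h \<otimes> inv g)"
    using g x h by simp
  then show "y \<in> conj_class G (g \<otimes> x \<otimes> inv g)"
    using g h(1) unfolding conj_class_def by blast
qed

text \<open>For a suitable power \<open>q\<close> of \<open>p\<close>, the map
  \<open>x [^] q\<close> sends the group to its \<open>p\<close>-regular elements and fixes each of
  these. Pulling functions on regular classes back along it is therefore injective.\<close>

lemma card_p'_classes_le:
  assumes fin: "finite (carrier G)" and p: "Factorial_Ring.prime p"
    and ord: "order G = p ^ e * m" and cop: "coprime m p"
  obtains n where "n > 0" "p ^ k_p' G p \<le> card (trace_functions {0..<int p} (p ^ n))"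
proof -
  have p1: "p > 1" using p by (rule prime_gt_1_nat)
  have m0: "m > 0" using ord fin order_gt_0_iff_finite by (metis gr0I mult_0_right)
  \<comment> \<open>The factor \<open>totient m\<close> gives \<open>q = 1\<close> modulo
    \<open>m\<close> by Euler; the factor \<open>Suc e\<close> makes \<open>p ^ e\<close> divide
    \<open>q\<close>.\<close>
  define n where "n = totient m * Suc e"
  define q where "q = p ^ n"
  have n: "n \<ge> Suc e" using mult_le_mono1[of 1 "totient m" "Suc e"] m0 by (simp add: n_def Suc_leI)
  have "[p ^ totient m = 1] (mod m)" using cop by (intro euler_theorem) (simp add: coprime_commute)
  from cong_pow[OF this, of "Suc e"] have q1: "[q = 1] (mod m)"
    unfolding q_def n_def power_mult by simp
  have q0: "q \<ge> 1" using p1 by (simp add: q_def)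
  then obtain j where j: "q = 1 + m * j"
    using q1 by (metis cong_to_1_nat cong_sym dvdE le_add_diff_inverse)
  have fixq: "y [^] q = y" if "y \<in> carrier G" "y [^] m = \<one>" for y
    using that by (simp add: j nat_pow_mult[symmetric] nat_pow_pow[symmetric] del: nat_pow_Suc)
  \<comment> \<open>Since \<open>n\<close> exceeds \<open>e\<close>, the product
    \<open>q * m\<close> is a multiple of the group order.\<close>
  have pm: "(x [^] q) [^] m = \<one>" if x: "x \<in> carrier G" for x
  proof -
    have "q * m = order G * p ^ (n - e)" using n by (simp add: q_def ord flip: power_add)
    then show ?thesis using x by (simp add: nat_pow_pow nat_pow_pow[symmetric] pow_order_eq_1)
  qed
  have reg: "x [^] q \<in> p'_elements G p" if x: "x \<in> carrier G" for x
  proof -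
    have "group.ord G (x [^] q) dvd m" using pow_eq_id[of "x [^] q" m] pm[OF x] x by simp
    moreover have "\<not> p dvd m" using cop p1 by (metis coprime_absorb_right coprime_commute nat_dvd_1_iff_1 nat_neq_iff)
    ultimately show ?thesis using x by (auto simp: p'_elements_def dest: dvd_trans)
  qed
  have fix_reg: "z [^] q = z" if z: "z \<in> p'_elements G p" for z
  proof -
    have zG: "z \<in> carrier G" and nd: "\<not> p dvd group.ord G z" using z by (auto simp: p'_elements_def)
    have "group.ord G z dvd p ^ e * m" using ord_dvd_group_order[OF zG] ord by simp
    moreover have "coprime (group.ord G z) (p ^ e)"
      using nd p by (metis coprime_commute coprime_power_left_iff prime_imp_coprime coprime_power_right_iff)
    ultimately have "group.ord G z dvd m" by (simp add: coprime_dvd_mult_right_iff)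
    then show ?thesis using fixq zG pow_eq_id by blast
  qed
  let ?K = "conj_class G ` p'_elements G p"
  have finK: "finite ?K" using fin by (auto simp: p'_elements_def)
  define \<sigma> where "\<sigma> \<kappa> = (\<lambda>x\<in>carrier G. \<kappa> (conj_class G (x [^] q)))" for \<kappa> :: "'a set \<Rightarrow> int"
  have "\<sigma> \<kappa> \<in> trace_functions {0..<int p} q" if \<kappa>: "\<kappa> \<in> ?K \<rightarrow>\<^sub>E {0..<int p}" for \<kappa>
    unfolding trace_functions_def
  proof (intro CollectI conjI ballI)
    show "\<sigma> \<kappa> \<in> carrier G \<rightarrow>\<^sub>E {0..<int p}"
      using \<kappa> reg unfolding \<sigma>_def by (intro restrict_PiE_iff[THEN iffD2] ballI) (auto dest!: PiE_mem)
  next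
    fix x y assume x: "x \<in> carrier G" and y: "y \<in> carrier G"
    \<comment> \<open>The two products are conjugate by \<open>y\<close>, and powers commute with
      conjugation.\<close>
    have "y \<otimes> x = y \<otimes> (x \<otimes> y) \<otimes> inv y" using x y by (simp add: m_assoc)
    then have "(y \<otimes> x) [^] q = y \<otimes> (x \<otimes> y) [^] q \<otimes> inv y"
      using pow_conjugate[of y "x \<otimes> y" q] x y by simp
    then have "conj_class G ((y \<otimes> x) [^] q) = conj_class G ((x \<otimes> y) [^] q)"
      using conj_class_conjugate[of y "(x \<otimes> y) [^] q"] x y by simp
    then show "\<sigma> \<kappa> (x \<otimes> y) = \<sigma> \<kappa> (y \<otimes> x)" using x y by (simp add: \<sigma>_def)
  next
    fix x assume x: "x \<in> carrier G"
    have "(x [^] q) [^] q = x [^] q" by (rule fix_reg[OF reg[OF x]])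
    then show "\<sigma> \<kappa> (x [^] q) = \<sigma> \<kappa> x" using x by (simp add: \<sigma>_def)
  qed
  moreover have "inj_on \<sigma> (?K \<rightarrow>\<^sub>E {0..<int p})"
  proof (rule inj_onI)
    fix \<kappa> \<kappa>' assume \<kappa>: "\<kappa> \<in> ?K \<rightarrow>\<^sub>E {0..<int p}" "\<kappa>' \<in> ?K \<rightarrow>\<^sub>E {0..<int p}" and eq: "\<sigma> \<kappa> = \<sigma> \<kappa>'"
    have "\<kappa> (conj_class G z) = \<kappa>' (conj_class G z)" if z: "z \<in> p'_elements G p" for z
      using fun_cong[OF eq, of z] fix_reg[OF z] z by (simp add: \<sigma>_def p'_elements_def)
    then show "\<kappa> = \<kappa>'" using \<kappa> by (intro PiE_ext[of _ ?K "\<lambda>_. {0..<int p}"]) auto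
  qed
  moreover have "finite (trace_functions {0..<int p} q)"
    using finite_PiE[OF fin, of "\<lambda>_. {0..<int p}"] by (auto simp: trace_functions_def)
  ultimately have "card (?K \<rightarrow>\<^sub>E {0..<int p}) \<le> card (trace_functions {0..<int p} q)"
    by (intro card_inj_on_le[of \<sigma>]) auto
  moreover have "card (?K \<rightarrow>\<^sub>E {0..<int p}) = p ^ k_p' G p"
    using finK by (simp add: card_PiE k_p'_def)
  ultimately show thesis using that[of n] n by (simp add: q_def)
qed

section \<open>Counting double cosets of a non-normal Sylow subgroup\<close>

text \<open>The fixed cosets make up the normalizer \<open>N\<close>, so
  \<open>m = card A.fixed * k\<close> with \<open>k\<close> the index of \<open>N\<close>. As in
  Sylow's theorem \<open>k = 1\<close> modulo \<open>p\<close>, and \<open>k \<noteq> 1\<close> then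
  forces \<open>k \<ge> p + 1\<close>; \<open>card_orbits_le\<close> does the rest.\<close>

lemma card_coset_orbits_le:
  assumes fin: "finite (carrier G)" and p: "Factorial_Ring.prime p"
    and P: "subgroup P G" "card P = p ^ e" and ord: "order G = p ^ e * m" and cop: "coprime m p"
    and nn: "\<not> P \<lhd> G"
  shows "(p + 1) * card (p_group_action.orb (G\<lparr>carrier := P\<rparr>) (\<lambda>u C. C #> inv u) ` (rcosets P)) \<le> 2 * m"
proof -
  interpret A: p_group_action "G\<lparr>carrier := P\<rparr>" "rcosets P" "\<lambda>u C. C #> inv u" p e
    by (rule right_coset_action[OF fin p P])
  interpret P: subgroup P G by (rule P)
  have p1: "p > 1" using p by (rule prime_gt_1_nat)
  have pe0: "p ^ e > 0" using p1 by simp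
  have finP: "finite P" using fin P.subset finite_subset by blast
  have T: "card (rcosets P) = m"
    using lagrange[OF P(1)] P(2) ord pe0 by (metis mult.commute mult_cancel1 less_numeral_extra(3))
  \<comment> \<open>The normalizer of \<open>P\<close>, given by one inclusion; since
    \<open>P\<close> is finite, conjugation maps it onto itself, which yields closure under
    inverses.\<close>
  define N where "N = {g \<in> carrier G. \<forall>u\<in>P. g \<otimes> u \<otimes> inv g \<in> P}"
  have Nsub: "N \<subseteq> carrier G" by (auto simp: N_def)
  have N: "subgroup N G"
  proof
    fix g h assume gh: "g \<in> N" "h \<in> N"
    have "g \<otimes> h \<otimes> u \<otimes> inv (g \<otimes> h) \<in> P" if u: "u \<in> P" for u
    proof -
      have "g \<otimes> h \<otimes> u \<otimes> inv (g \<otimes> h) = g \<otimes> (h \<otimes> u \<otimes> inv h) \<otimes> inv g"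
        using gh u by (simp add: N_def inv_mult_group m_assoc)
      then show ?thesis using gh u by (simp add: N_def)
    qed
    then show "g \<otimes> h \<in> N" using gh by (simp add: N_def)
  next
    fix g assume g: "g \<in> N"
    have gG: "g \<in> carrier G" using g by (simp add: N_def)
    let ?c = "\<lambda>u. g \<otimes> u \<otimes> inv g"
    have "inj_on ?c P" using gG by (auto intro!: inj_onI)
    moreover have "?c ` P \<subseteq> P" using g by (auto simp: N_def)
    ultimately have img: "?c ` P = P" using finP by (simp add: endo_inj_surj)
    have "inv g \<otimes> u \<otimes> inv (inv g) \<in> P" if u: "u \<in> P" for u
    proof -
      obtain v where v: "v \<in> P" "u = g \<otimes> v \<otimes> inv g" using img u by blast
      have "inv g \<otimes> (g \<otimes> v \<otimes> inv g) \<otimes> g = (inv g \<otimes> g) \<otimes> v \<otimes> (inv g \<otimes> g)"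
        using gG v(1) by (simp only: m_assoc m_closed inv_closed P.mem_carrier)
      then show ?thesis using v gG by simp
    qed
    then show "inv g \<in> N" using gG by (simp add: N_def)
  qed (auto simp: N_def)
  have PN: "P \<subseteq> N" by (auto simp: N_def)
  have fixed_iff: "P #> g \<in> A.fixed \<longleftrightarrow> g \<in> N" if g: "g \<in> carrier G" for g
  proof -
    have "P #> g \<in> A.fixed \<longleftrightarrow> (\<forall>u\<in>P. P #> (g \<otimes> inv u) = P #> g)"
      using g by (auto simp: A.fixed_def coset_mult_assoc P.subset rcosetsI)
    also have "\<dots> \<longleftrightarrow> (\<forall>u\<in>P. g \<otimes> inv u \<otimes> inv g \<in> P)"
      using g by (simp add: rcoset_mult_eq_iff[OF P(1)])
    also have "\<dots> \<longleftrightarrow> g \<in> N"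
      using g by (auto simp: N_def) (metis P.m_inv_closed P.mem_carrier inv_inv)
    finally show ?thesis .
  qed
  have fixed_sub: "A.fixed \<subseteq> rcosets P" by (auto simp: A.fixed_def)
  have union: "\<Union>A.fixed = N"
  proof (intro equalityI subsetI)
    fix x assume "x \<in> \<Union>A.fixed"
    then obtain C where C: "C \<in> A.fixed" "x \<in> C" by blast
    then obtain g where g: "g \<in> carrier G" "C = P #> g" using fixed_sub by (auto simp: RCOSETS_def)
    then have "g \<in> N" using fixed_iff C by blast
    then show "x \<in> N" using C g PN subgroup.m_closed[OF N] by (auto simp: r_coset_def)
  next
    fix x assume "x \<in> N"
    then show "x \<in> \<Union>A.fixed" using fixed_iff Nsub rcos_self[OF _ P(1)] by blast
  qed
  have finF: "finite A.fixed" using A.fin fixed_sub finite_subset by blast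
  have "card P * card A.fixed = card (\<Union>A.fixed)"
  proof (rule card_partition)
    show "finite (\<Union>A.fixed)" unfolding union using Nsub fin finite_subset by blast
    show "card C = card P" if "C \<in> A.fixed" for C
      using card_rcosets_equal[OF subsetD[OF fixed_sub that] P.subset] by simp
    show "C \<inter> D = {}" if "C \<in> A.fixed" "D \<in> A.fixed" "C \<noteq> D" for C D
      using pairwiseD[OF rcos_disjoint[OF P(1)] subsetD[OF fixed_sub that(1)]
          subsetD[OF fixed_sub that(2)] that(3)] by (simp add: disjnt_def)
  qed (rule finF)
  then have cardN: "card N = p ^ e * card A.fixed" using P(2) union by simp
  have "card N dvd order G" using lagrange[OF N] by (metis dvd_triv_right)
  then have "card A.fixed dvd m" using cardN ord p1 by simp
  then obtain k where k: "m = card A.fixed * k" by blast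
  let ?f = "card A.fixed"
  have np: "\<not> p dvd ?f"
    using k cop p1 by (metis coprime_absorb_right coprime_commute dvd_mult2 nat_dvd_1_iff_1 nat_neq_iff)
  have m0: "m > 0" using ord fin order_gt_0_iff_finite by (metis gr0I mult_0_right)
  have k0: "k > 0" using k m0 by (cases k) auto
  \<comment> \<open>The number \<open>m\<close> of cosets is congruent to the number of fixed ones,
    and the latter is coprime to \<open>p\<close> and can be cancelled.\<close>
  have "[?f * k = ?f * 1] (mod p)" using A.card_cong_fixed T k by simp
  moreover have "coprime ?f p" using np p by (metis coprime_commute prime_imp_coprime)
  ultimately have "[k = 1] (mod p)" using cong_mult_lcancel_nat by blast
  then have "p dvd k - 1" using k0 by (metis One_nat_def Suc_leI cong_altdef_nat cong_sym)
  moreover have "k \<noteq> 1"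
  proof
    assume "k = 1"
    then have "card N = order G" using cardN k ord by simp
    then have "N = carrier G" using Nsub fin by (simp add: order_def card_subset_eq)
    then have "P \<lhd> G" unfolding normal_inv_iff using P(1) by (auto simp: N_def)
    then show False using nn by simp
  qed
  ultimately have "k - 1 \<ge> p" using k0 by (intro dvd_imp_le) auto
  then have "p + 1 \<le> k" using k0 by simp
  then have k: "(p + 1) * ?f \<le> m" unfolding k mult.commute[of ?f k] by (rule mult_le_mono1)
  let ?O = "card (A.orb ` (rcosets P))"
  have "p * ?O \<le> m + (p - 1) * ?f" using A.card_orbits_le T by simp
  \<comment> \<open>Multiplying by \<open>p + 1\<close> lets the bound for \<open>?f\<close> be
    inserted without division.\<close>
  then have "p * ((p + 1) * ?O) \<le> (p + 1) * m + (p - 1) * ((p + 1) * ?f)"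
    by (metis distrib_left mult.left_commute mult_le_mono2)
  also have "\<dots> \<le> (p + 1) * m + (p - 1) * m" using k by (intro add_left_mono mult_le_mono2)
  also have "\<dots> = p * (2 * m)" using p1 by (cases p) (auto simp: algebra_simps)
  finally show ?thesis using p1 by simp
qed

end

section \<open>From the class bound to the ratio d_p'\<close>

theorem theorem1p3:
  fixes G :: "('a, 'b) monoid_scheme" and p :: nat
  assumes "group G" and "finite (carrier G)" and "Factorial_Ring.prime p"
    and "d_p' G p > 2 / (real p + 1)"
  shows "\<exists>P. sylow_subgroup G p P \<and> P \<lhd> G"
proof -
  interpret group G by fact
  have p1: "p > 1" using assms(3) by (rule prime_gt_1_nat)
  have o0: "order G > 0" using assms(2) by (simp add: order_gt_0_iff_finite)
  define e where "e = multiplicity p (order G)"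
  obtain m where m: "order G = p ^ e * m" "\<not> p dvd m"
    unfolding e_def using multiplicity_decompose'[of "order G" p] o0 p1 assms(3)
    by (metis not_prime_unit not_gr_zero)
  have cop: "coprime m p" using m(2) assms(3) by (metis coprime_commute prime_imp_coprime)
  obtain P where P: "subgroup P G" "card P = p ^ e"
    using sylow_thm[OF assms(3) assms(1) m(1) assms(2)] by blast
  have "P \<lhd> G"
  proof (rule ccontr)
    assume nn: "\<not> P \<lhd> G"
    let ?O = "card (p_group_action.orb (G\<lparr>carrier := P\<rparr>) (\<lambda>u C. C #>\<^bsub>G\<^esub> inv\<^bsub>G\<^esub> u) ` (rcosets\<^bsub>G\<^esub> P))"
    obtain n where n: "n > 0" "p ^ k_p' G p \<le> card (trace_functions {0..<int p} (p ^ n))"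
      by (rule card_p'_classes_le[OF assms(2,3) m(1) cop])
    \<comment> \<open>Both bounds count functions with \<open>p\<close> values, so comparing
      exponents compares classes with double cosets.\<close>
    then have "p ^ k_p' G p \<le> p ^ ?O"
      using card_trace_functions_le[OF assms(2,3) P n(1)] by linarith
    then have "k_p' G p \<le> ?O" by (rule power_le_imp_le_exp[OF p1])
    then have "(p + 1) * k_p' G p \<le> 2 * m"
      using card_coset_orbits_le[OF assms(2,3) P m(1) cop nn] by (meson mult_le_mono2 order_trans)
    \<comment> \<open>The index \<open>m\<close> is itself a divisor coprime to \<open>p\<close>,
      hence at most the maximum that defines \<open>order_p'\<close>.\<close>
    moreover have "m \<le> order_p' G p"
      unfolding order_p'_def using o0 m cop by (intro Max_ge) (auto intro: finite_divisors_nat)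
    ultimately have "(p + 1) * k_p' G p \<le> 2 * order_p' G p" by linarith
    then have "real ((p + 1) * k_p' G p) \<le> real (2 * order_p' G p)" by (simp only: of_nat_le_iff)
    then have "(real p + 1) * real (k_p' G p) \<le> 2 * real (order_p' G p)" by (simp add: algebra_simps)
    moreover have "order_p' G p > 0" using \<open>m \<le> order_p' G p\<close> m(1) o0 by (cases m) auto
    ultimately have "d_p' G p \<le> 2 / (real p + 1)"
      by (simp add: d_p'_def field_simps)
    then show False using assms(4) by simp
  qed
  then show ?thesis using P by (auto simp: sylow_subgroup_def e_def)
qed

end
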